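(* Let $p\ge1$, $m=2p$, $j=\mathrm{diag}(I_p,-I_p)$, $n>0$. Let $A$ be an $n\times n$ matrix with $\det A\neq0$, $S_0>0$ an $n\times n$ matrix, and $\Pi_0=[\Phi\ \ \Psi]$ an $n\times m$ matrix ($\Phi,\Psi$ of size $n\times p$) with $AS_0-S_0A^*=i\Pi_0j\Pi_0^*$. Define for $k\ge0$ $$\Pi_{k+1}=\Pi_k+iA^{-1}\Pi_kj,\quad S_{k+1}=S_k+A^{-1}S_k(A^* )^{-1}+A^{-1}\Pi_k\Pi_k^*(A^* )^{-1},\quad C_k=I_m+\Pi_k^*S_k^{-1}\Pi_k-\Pi_{k+1}^*S_{k+1}^{-1}\Pi_{k+1}.$$ Then the system $W_{k+1}(\lambda)-W_k(\lambda)=-\frac{i}{\lambda}jC_kW_k(\lambda)$ is well defined for all $k\ge0$, and it has a unique Weyl function (in the sense defined in the context), namely $$\varphi(\lambda)=-i\Phi^*S_0^{-1}(A^{\times}-\lambda I_n)^{-1}\Psi,\qquad A^{\times}=A+i\Psi\Psi^*S_0^{-1}.$$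
   Context: $W_k(\lambda)$ denotes the solution of the system with $W_0(\lambda)=I_m$; $\mathbb C_-$ is the open lower half-plane; $q(\lambda)=|\lambda|^2(|\lambda|^2+1)^{-1}$. For a system of this form on $k\ge0$ with $C_k>0$, $C_k=C_k^*$, $C_kjC_k=j$, a $p\times p$ matrix function $\varphi$ holomorphic in $\mathbb C_-$ is called a Weyl function if for every $\lambda\in\mathbb C_-$ $$\sum_{k=0}^\infty [\varphi(\lambda)^*\ \ I_p]\,q(\lambda)^kW_k(\lambda)^*C_kW_k(\lambda)\begin{bmatrix}\varphi(\lambda)\\ I_p\end{bmatrix}<\infty,$$ i.e. this series of positive semidefinite matrices converges. *)

theory Defs
  imports "HOL-Analysis.Analysis"
begin

text \<open>Complex matrices are type-indexed: an r x c matrix is complex^'c^'r.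
  The index type of C^m, m = 2p, is 'p::finite + 'p (first block Inl, second block Inr).\<close>

definition adj :: "complex^'c^'r \<Rightarrow> complex^'r^'c" where
  "adj M = (\<chi> i j. cnj (M $ j $ i))"

definition smul :: "complex \<Rightarrow> complex^'c^'r \<Rightarrow> complex^'c^'r" where
  "smul z M = (\<chi> i j. z * M $ i $ j)"

definition pos_def :: "complex^'n::finite^'n \<Rightarrow> bool" where
  "pos_def S \<longleftrightarrow> adj S = S \<and>
     (\<forall>x::complex^'n. x \<noteq> 0 \<longrightarrow> 0 < Re (\<Sum>i\<in>UNIV. cnj (x $ i) * (S *v x) $ i))"

definition jmat :: "complex^('p::finite + 'p)^('p::finite + 'p)" where
  "jmat = (\<chi> a b. if a = b then (case a of Inl _ \<Rightarrow> 1 | Inr _ \<Rightarrow> -1) else 0)"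

definition hblock :: "complex^'p::finite^'n::finite \<Rightarrow> complex^'p::finite^'n::finite \<Rightarrow> complex^('p::finite + 'p)^'n" where
  "hblock Phi Psi = (\<chi> i b. case b of Inl a \<Rightarrow> Phi $ i $ a | Inr a \<Rightarrow> Psi $ i $ a)"

definition vblock_id :: "complex^'p::finite^'p \<Rightarrow> complex^'p^('p::finite + 'p)" where
  "vblock_id F = (\<chi> b c. case b of Inl a \<Rightarrow> F $ a $ c | Inr a \<Rightarrow> (if a = c then 1 else 0))"

primrec PiSeq :: "complex^'n::finite^'n \<Rightarrow> complex^('p::finite + 'p)^'n \<Rightarrow> nat \<Rightarrow> complex^('p::finite + 'p)^'n" where
  "PiSeq A Pi0 0 = Pi0"
| "PiSeq A Pi0 (Suc k) = PiSeq A Pi0 k + smul \<i> (matrix_inv A ** PiSeq A Pi0 k ** jmat)"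

primrec SSeq :: "complex^'n::finite^'n \<Rightarrow> complex^'n::finite^'n \<Rightarrow> complex^('p::finite + 'p)^'n \<Rightarrow> nat \<Rightarrow> complex^'n::finite^'n" where
  "SSeq A S0 Pi0 0 = S0"
| "SSeq A S0 Pi0 (Suc k) = SSeq A S0 Pi0 k
     + matrix_inv A ** SSeq A S0 Pi0 k ** matrix_inv (adj A)
     + matrix_inv A ** PiSeq A Pi0 k ** adj (PiSeq A Pi0 k) ** matrix_inv (adj A)"

definition CSeq :: "complex^'n::finite^'n \<Rightarrow> complex^'n::finite^'n \<Rightarrow> complex^('p::finite + 'p)^'n \<Rightarrow> nat
    \<Rightarrow> complex^('p::finite + 'p)^('p::finite + 'p)" where
  "CSeq A S0 Pi0 k = mat 1
     + adj (PiSeq A Pi0 k) ** matrix_inv (SSeq A S0 Pi0 k) ** PiSeq A Pi0 k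
     - adj (PiSeq A Pi0 (Suc k)) ** matrix_inv (SSeq A S0 Pi0 (Suc k)) ** PiSeq A Pi0 (Suc k)"

primrec Wsol :: "(nat \<Rightarrow> complex^('p::finite + 'p)^('p::finite + 'p)) \<Rightarrow> complex \<Rightarrow> nat \<Rightarrow> complex^('p::finite + 'p)^('p::finite + 'p)" where
  "Wsol C z 0 = mat 1"
| "Wsol C z (Suc k) = Wsol C z k - smul (\<i> / z) (jmat ** C k ** Wsol C z k)"

definition qfun :: "complex \<Rightarrow> real" where
  "qfun z = (cmod z)^2 / ((cmod z)^2 + 1)"

definition lower_half :: "complex set" where
  "lower_half = {z. Im z < 0}"

definition is_weyl_function :: "(nat \<Rightarrow> complex^('p::finite + 'p)^('p::finite + 'p)) \<Rightarrow> (complex \<Rightarrow> complex^'p::finite^'p) \<Rightarrow> bool" where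
  "is_weyl_function C \<phi> \<longleftrightarrow>
     (\<forall>a b. (\<lambda>z. \<phi> z $ a $ b) holomorphic_on lower_half) \<and>
     (\<forall>z\<in>lower_half. summable (\<lambda>k.
        adj (vblock_id (\<phi> z)) ** (qfun z ^ k *\<^sub>R (adj (Wsol C z k) ** C k ** Wsol C z k))
          ** vblock_id (\<phi> z)))"

end

theory Submission
  imports Defs
begin

text \<open>
  Each step \<open>(\<Pi>\<^sub>k, S\<^sub>k) \<mapsto> (\<Pi>\<^sub>k\<^sub>+\<^sub>1, S\<^sub>k\<^sub>+\<^sub>1)\<close> preserves
  \<open>AS - SA\<^sup>* = i\<Pi>j\<Pi>\<^sup>*\<close> and \<open>S > 0\<close>, which yields \<open>CjC = j\<close> by algebra
  and \<open>C > 0\<close> by completing squares.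

  The identity \<open>q W'\<^sup>*jW' = W\<^sup>*jW + \<kappa> W\<^sup>*CW\<close> with \<open>\<kappa> = -2 Im z / (|z|\<^sup>2 + 1) > 0\<close>
  telescopes, so the Weyl series converges on a vector once its \<open>j\<close>-form stays nonpositive along the
  solution. For \<open>(\<phi>(z)u, u)\<close> the solution is
  \<open>(1 + i/z)\<^sup>k (e - i j \<Pi>\<^sub>k\<^sup>* S\<^sub>k\<^sup>-\<^sup>1 x\<^sub>k)\<close> with \<open>e = (0, d)\<close>,
  \<open>(A - z) x\<^sub>k = \<Pi>\<^sub>k e\<close>, and its \<open>j\<close>-form is a nonnegative multiple of
  \<open>-d\<^sup>*d + 2 Im z x\<^sub>k\<^sup>*S\<^sub>k\<^sup>-\<^sup>1x\<^sub>k \<le> 0\<close>. Working with \<open>x\<^sub>0 = (A\<^sup>\<times> - z)\<^sup>-\<^sup>1\<Psi>u\<close>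
  instead of a resolvent of \<open>A\<close> covers the eigenvalues of \<open>A\<close> in the lower half-plane as well.

  For uniqueness, the difference of two Weyl functions gives vectors \<open>(f, 0)\<close> with summable energy,
  but \<open>C \<ge> j\<close> and monotonicity of the \<open>j\<close>-form bound every term below by \<open>|f|\<^sup>2\<close>.

  The real inner product of \<open>complex^'n\<close> is the real part of the Hermitian one, so Hermitian forms
  are written with it throughout.
\<close>

section \<open>Adjoints, Hermitian forms and inverses of complex matrices\<close>

lemma smul_mult_vec: "smul c M *v x = c *s (M *v x)"
  by (simp add: vec_eq_iff matrix_vector_mult_def smul_def sum_distrib_left algebra_simps)

lemma inner_vec_Re: "x \<bullet> y = Re (\<Sum>i\<in>UNIV. cnj (x $ i) * y $ i)" for x y :: "complex^'n"
  by (simp add: inner_vec_def inner_complex_def)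

lemma inner_adj: "(M *v x) \<bullet> y = x \<bullet> (adj M *v y)" for M :: "complex^'c^'r"
proof -
  have "(\<Sum>i\<in>UNIV. cnj ((M *v x) $ i) * y $ i) = (\<Sum>i\<in>UNIV. cnj (x $ i) * (adj M *v y) $ i)"
    unfolding matrix_vector_mult_def adj_def
    by (simp add: sum_distrib_left sum_distrib_right) (subst sum.swap, simp add: algebra_simps)
  then show ?thesis by (simp only: inner_vec_Re)
qed

lemma inner_smult_left: "(c *s x) \<bullet> y = x \<bullet> (cnj c *s y)" for x y :: "complex^'n"
  by (simp add: inner_vec_Re algebra_simps)

lemma adj_adj [simp]: "adj (adj M) = M"
  by (simp add: adj_def vec_eq_iff)

lemma adj_mult: "adj (M ** N) = adj N ** adj M" for M :: "complex^'b^'a" and N :: "complex^'c^'b"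
  by (simp add: adj_def vec_eq_iff matrix_matrix_mult_def mult.commute)

lemma adj_add: "adj (M + N) = adj M + adj N"
  by (simp add: adj_def vec_eq_iff)

lemma adj_diff: "adj (M - N) = adj M - adj N"
  by (simp add: adj_def vec_eq_iff)

lemma adj_smul: "adj (smul c M) = smul (cnj c) (adj M)"
  by (simp add: adj_def smul_def vec_eq_iff)

lemma adj_scaleR: "adj (r *\<^sub>R M) = r *\<^sub>R adj M"
  by (simp add: adj_def vec_eq_iff)

lemma adj_one [simp]: "adj (mat 1) = mat 1"
  by (simp add: adj_def mat_def vec_eq_iff)

lemma adj_jmat [simp]: "adj jmat = jmat"
  by (auto simp: adj_def jmat_def vec_eq_iff split: sum.split)

lemma pos_def_iff: "pos_def S \<longleftrightarrow> adj S = S \<and> (\<forall>x. x \<noteq> 0 \<longrightarrow> 0 < x \<bullet> (S *v x))"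
  by (simp add: pos_def_def inner_vec_Re)

lemma pos_def_nonneg: "pos_def S \<Longrightarrow> 0 \<le> x \<bullet> (S *v x)"
  by (cases "x = 0") (auto simp: pos_def_iff less_imp_le)

lemma invertible_if_inj: 
  fixes M :: "complex^'n^'n"
  assumes "\<And>x. M *v x = 0 \<Longrightarrow> x = 0"
  shows "invertible M"
  using assms invertible_left_inverse matrix_left_invertible_ker by blast

lemma pos_def_invertible: "pos_def S \<Longrightarrow> invertible S"
  by (rule invertible_if_inj) (metis pos_def_iff inner_zero_right less_irrefl)

lemma matrix_inv:
  fixes M :: "complex^'n^'n"
  assumes "invertible M"
  shows "M ** matrix_inv M = mat 1" "matrix_inv M ** M = mat 1"
  using someI_ex[OF assms[unfolded invertible_def]] by (simp_all add: matrix_inv_def)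

lemma matrix_inv_unique:
  fixes M N :: "complex^'n^'n"
  assumes "M ** N = mat 1" "N ** M = mat 1"
  shows "matrix_inv M = N"
proof -
  have "invertible M" using assms by (auto simp: invertible_def)
  then show ?thesis
    by (metis assms(1) matrix_inv(2) matrix_mul_assoc matrix_mul_lid matrix_mul_rid)
qed

lemma matrix_inv_vec:
  fixes M :: "complex^'n^'n"
  assumes "invertible M"
  shows "M *v (matrix_inv M *v x) = x" "matrix_inv M *v (M *v x) = x"
  using assms by (simp_all add: matrix_vector_mul_assoc matrix_inv(1) matrix_inv(2))

lemma adj_matrix_inv:
  fixes M :: "complex^'n^'n"
  assumes "invertible M"
  shows "matrix_inv (adj M) = adj (matrix_inv M)"
proof (rule matrix_inv_unique)
  show "adj M ** adj (matrix_inv M) = mat 1" "adj (matrix_inv M) ** adj M = mat 1"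
    using assms by (simp_all add: adj_mult[symmetric] matrix_inv(1) matrix_inv(2))
qed

text \<open>Normal form: products become iterated applications to a vector, scalars outermost, so
  that noncommutative matrix identities reduce to linear algebra on vectors.\<close>

lemmas mv_simps = matrix_vector_mul_assoc[symmetric] matrix_vector_right_distrib
  matrix_vector_mult_add_rdistrib matrix_vector_mult_diff_distrib
  matrix_vector_mult_diff_rdistrib vector_scalar_commute smul_mult_vec

section \<open>Block vectors in dimension 2p\<close>

definition vpair :: "complex^'p::finite \<Rightarrow> complex^'p \<Rightarrow> complex^('p + 'p)" where
  "vpair x y = (\<chi> b. case b of Inl a \<Rightarrow> x $ a | Inr a \<Rightarrow> y $ a)"

lemma sum_UNIV_Plus: "sum f (UNIV :: ('a::finite + 'b::finite) set) = (\<Sum>a\<in>UNIV. f (Inl a)) + (\<Sum>b\<in>UNIV. f (Inr b))"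
  by (subst UNIV_Plus_UNIV[symmetric], subst sum.Plus) auto

lemma vec_eq_iff_sum: "v = w \<longleftrightarrow> (\<forall>a. v $ Inl a = w $ Inl a) \<and> (\<forall>b. v $ Inr b = w $ Inr b)"
  for v w :: "'c^('a::finite+'b::finite)"
  by (metis sum.exhaust vec_eq_iff)

lemma vpair_nth [simp]: "vpair x y $ Inl a = x $ a" "vpair x y $ Inr a = y $ a"
  by (simp_all add: vpair_def)

lemma hblock_vpair: "hblock P Q *v vpair x y = P *v x + Q *v y"
  by (simp add: vec_eq_iff matrix_vector_mult_def sum_UNIV_Plus hblock_def)

lemma adj_hblock_vec: "adj (hblock P Q) *v y = vpair (adj P *v y) (adj Q *v y)"
  by (simp add: vec_eq_iff_sum matrix_vector_mult_def hblock_def adj_def)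

lemma jmat_vpair: "jmat *v vpair x y = vpair x (- y)"
  by (simp add: vec_eq_iff_sum matrix_vector_mult_def sum_UNIV_Plus jmat_def if_distrib[of "\<lambda>c. c * _"] cong: if_cong)

lemma vblock_id_vec: "vblock_id F *v u = vpair (F *v u) u"
  by (simp add: vec_eq_iff_sum matrix_vector_mult_def vblock_id_def if_distrib[of "\<lambda>c. c * _"] cong: if_cong)

lemma inner_vpair: "vpair a b \<bullet> vpair c d = a \<bullet> c + b \<bullet> d"
  by (simp add: inner_vec_def sum_UNIV_Plus)

lemma vpair_cases: obtains x y where "v = vpair x y"
  by (rule that[of "\<chi> a. v $ Inl a" "\<chi> a. v $ Inr a"]) (simp add: vec_eq_iff_sum)

lemma jmat_jmat_vec [simp]: "jmat *v (jmat *v v) = v"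
  by (rule vpair_cases[of v]) (simp add: jmat_vpair)

lemma inner_jmat: "(jmat *v v) \<bullet> w = v \<bullet> (jmat *v w)"
  using inner_adj[of jmat] by simp


section \<open>One step of the recursion\<close>

locale backlund_step =
  fixes A S S' :: "complex^'n^'n" and P P' :: "complex^('p::finite + 'p)^'n"
  assumes invA: "invertible A"
    and posS: "pos_def S"
    and ident: "A ** S - S ** adj A = smul \<i> (P ** jmat ** adj P)"
    and P': "P' = P + smul \<i> (matrix_inv A ** P ** jmat)"
    and S': "S' = S + matrix_inv A ** S ** matrix_inv (adj A)
      + matrix_inv A ** P ** adj P ** matrix_inv (adj A)"
begin

abbreviation "B \<equiv> matrix_inv A"
abbreviation "T \<equiv> matrix_inv S"
abbreviation "T' \<equiv> matrix_inv S'"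
definition "C = mat 1 + adj P ** T ** P - adj P' ** T' ** P'"

lemma adjS: "adj S = S" using posS by (simp add: pos_def_iff)
lemma adjB: "matrix_inv (adj A) = adj B" by (rule adj_matrix_inv[OF invA])

lemma P'_vec: "P' *v x = P *v x + \<i> *s (B *v (P *v (jmat *v x)))"
  by (simp add: P' mv_simps)

lemma adjP'_vec: "adj P' *v x = adj P *v x - \<i> *s (jmat *v (adj P *v (adj B *v x)))"
  by (simp add: P' mv_simps adj_add adj_smul adj_mult vector_smult_lneg)

lemma S'_vec: "S' *v x = S *v x + B *v (S *v (adj B *v x)) + B *v (P *v (adj P *v (adj B *v x)))"
  by (simp add: S' mv_simps adjB)

lemma A_B [simp]: "A *v (B *v x) = x" "B *v (A *v x) = x"
  using matrix_inv_vec[OF invA] by auto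

lemma adjA_adjB [simp]: "adj A *v (adj B *v x) = x" "adj B *v (adj A *v x) = x"
  by (simp_all add: matrix_vector_mul_assoc adj_mult[symmetric] matrix_inv[OF invA])

lemma S_T [simp]: "S *v (T *v x) = x" "T *v (S *v x) = x"
  using matrix_inv_vec[OF pos_def_invertible[OF posS]] by auto

text \<open>The identity solved for \<open>P ** jmat ** adj P\<close>, as a rewrite rule that
  eliminates this product from the computations below.\<close>

lemma PjP_vec: "P *v (jmat *v (adj P *v x)) = - \<i> *s (A *v (S *v x) - S *v (adj A *v x))"
proof -
  have "\<i> *s (P *v (jmat *v (adj P *v x))) = A *v (S *v x) - S *v (adj A *v x)"
    using arg_cong[OF ident, of "\<lambda>M. M *v x"] by (simp add: mv_simps)
  from arg_cong[OF this, of "\<lambda>y. - \<i> *s y"] show ?thesis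
    by (simp add: vector_smult_assoc)
qed

lemma S'_pos: "pos_def S'"
  unfolding pos_def_iff
proof (intro conjI allI impI)
  show "adj S' = S'"
    by (simp add: S' adjB adj_add adj_mult adjS matrix_mul_assoc)
next
  fix x :: "complex^'n" assume "x \<noteq> 0"
  have "x \<bullet> (S' *v x) = x \<bullet> (S *v x) + (adj B *v x) \<bullet> (S *v (adj B *v x))
    + (adj P *v (adj B *v x)) \<bullet> (adj P *v (adj B *v x))"
    by (simp add: S'_vec inner_simps inner_adj)
  moreover have "0 < x \<bullet> (S *v x)" using \<open>x \<noteq> 0\<close> posS by (simp add: pos_def_iff)
  ultimately show "0 < x \<bullet> (S' *v x)" using pos_def_nonneg[OF posS] by (smt (verit) inner_ge_zero)
qed

lemma adjS': "adj S' = S'" using S'_pos by (simp add: pos_def_iff)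

lemma S'_T' [simp]: "S' *v (T' *v x) = x" "T' *v (S' *v x) = x"
  using matrix_inv_vec[OF pos_def_invertible[OF S'_pos]] by auto

lemma adjT: "adj T = T" "adj T' = T'"
  using adj_matrix_inv[OF pos_def_invertible[OF posS]] adj_matrix_inv[OF pos_def_invertible[OF S'_pos]]
  by (simp_all add: adjS adjS')

text \<open>Conjugating \<open>ident\<close> by \<open>B\<close> turns the quadratic term of the
  right-hand side into \<open>S ** adj B - B ** S\<close>, and the cross terms match the
  contribution of \<open>P ** adj P\<close> to \<open>S'\<close>. Together with
  \<open>S'_pos\<close> this restores the hypotheses for the next step.\<close>

lemma ident': "A ** S' - S' ** adj A = smul \<i> (P' ** jmat ** adj P')"
  unfolding matrix_eq
  by (simp add: mv_simps S'_vec P'_vec adjP'_vec PjP_vec vec_eq_iff algebra_simps)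

text \<open>The intertwining relation behind all the identities for \<open>C\<close>.\<close>

lemma intertwine: "S' *v (adj A *v x) + \<i> *s (P' *v (jmat *v (adj P *v x)))
    = A *v (S *v x) + B *v (S *v x)"
  by (simp add: mv_simps S'_vec P'_vec PjP_vec vec_eq_iff algebra_simps)

lemma C_vec: "C *v x = x + adj P *v (T *v (P *v x)) - adj P' *v (T' *v (P' *v x))"
  by (simp add: C_def mv_simps)

lemma P'jP_vec: "P' *v (jmat *v (adj P *v x)) = - \<i> *s (A *v (S *v x) + B *v (S *v x) - S' *v (adj A *v x))"
  using intertwine[of x, symmetric] by (simp add: vector_smult_assoc)

lemma PjP'_vec: "P *v (jmat *v (adj P' *v x)) = \<i> *s (S *v (adj A *v x + adj B *v x) - A *v (S' *v x))"
  by (simp add: mv_simps S'_vec adjP'_vec PjP_vec vec_eq_iff algebra_simps)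

lemma P'jP'_vec: "P' *v (jmat *v (adj P' *v x)) = - \<i> *s (A *v (S' *v x) - S' *v (adj A *v x))"
  by (simp add: mv_simps S'_vec P'_vec adjP'_vec PjP_vec vec_eq_iff algebra_simps)

text \<open>Once the products around \<open>jmat\<close> are rewritten through \<open>A\<close>,
  \<open>S\<close> and \<open>S'\<close>, the recursion for \<open>P'\<close> applied to
  \<open>adj P' ** adj A\<close> cancels the remaining terms. With \<open>C_jP'T'\<close> this
  evaluates \<open>C ** jmat\<close> on the two nontrivial terms of \<open>C\<close>, as
  \<open>CjC_vec\<close> requires.\<close>

lemma C_jPT: "C *v (jmat *v (adj P *v (T *v x)))
    = \<i> *s (adj P' *v (T' *v (A *v x + B *v x))) - \<i> *s (adj P *v (T *v (A *v x)))"
  by (simp add: C_vec mv_simps P'jP_vec PjP_vec adjP'_vec vec_eq_iff algebra_simps)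

lemma C_jP'T': "C *v (jmat *v (adj P' *v (T' *v x)))
    = \<i> *s (adj P' *v (T' *v (A *v x))) - \<i> *s (adj P *v (T *v (A *v x)))"
  unfolding C_vec PjP'_vec P'jP'_vec
  by (simp add: mv_simps adjP'_vec vec_eq_iff algebra_simps)

lemma CjC_vec: "C *v (jmat *v (C *v x)) = jmat *v x"
proof -
  have "C *v (jmat *v (C *v x)) = C *v (jmat *v x) + C *v (jmat *v (adj P *v (T *v (P *v x))))
      - C *v (jmat *v (adj P' *v (T' *v (P' *v x))))"
    by (simp add: C_vec[of x] mv_simps)
  also have "\<dots> = jmat *v x"
    unfolding C_jPT C_jP'T' unfolding C_vec
    by (simp add: mv_simps P'_vec vec_eq_iff algebra_simps)
  finally show ?thesis .
qed

lemma CjC: "C ** jmat ** C = jmat"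
  by (simp add: matrix_eq mv_simps CjC_vec)

lemma adjC: "adj C = C"
  by (simp add: C_def adj_add adj_diff adj_mult adjT matrix_mul_assoc)

text \<open>Completing squares in the variational form of \<open>P'\<^sup>* S'\<^sup>-\<^sup>1 P'\<close>,
  with \<open>y = S'\<^sup>-\<^sup>1 P' v\<close> and \<open>w = A\<^sup>-\<^sup>* y\<close>.\<close>

lemma C_form:
  fixes v :: "complex^('p + 'p)"
  defines "y \<equiv> T' *v (P' *v v)"
  defines "w \<equiv> adj B *v y"
  shows "v \<bullet> (C *v v) = (y - T *v (P *v v)) \<bullet> (S *v (y - T *v (P *v v)))
    + (adj P *v w - \<i> *s (jmat *v v)) \<bullet> (adj P *v w - \<i> *s (jmat *v v)) + w \<bullet> (S *v w)"
proof -
  let ?g = "(P' *v v) \<bullet> y"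
  let ?c = "w \<bullet> (\<i> *s (P *v (jmat *v v)))"
  have 1: "v \<bullet> (C *v v) = v \<bullet> v + (P *v v) \<bullet> (T *v (P *v v)) - ?g"
    by (simp add: C_vec inner_simps inner_adj y_def)
  have "?g = y \<bullet> (S' *v y)" by (simp add: y_def inner_commute)
  also have "\<dots> = y \<bullet> (S *v y) + w \<bullet> (S *v w) + (adj P *v w) \<bullet> (adj P *v w)"
    by (simp add: S'_vec inner_simps inner_adj w_def)
  finally have 2: "?g = y \<bullet> (S *v y) + w \<bullet> (S *v w) + (adj P *v w) \<bullet> (adj P *v w)" .
  have 3: "?g = y \<bullet> (P *v v) + ?c"
    by (simp add: P'_vec inner_simps inner_adj w_def vector_scalar_commute inner_commute[of _ y])
  have 4: "(T *v (P *v v)) \<bullet> (S *v z) = (P *v v) \<bullet> z" for z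
    using inner_adj[of T "P *v v" "S *v z"] by (simp add: adjT)
  have 5: "(adj P *v w) \<bullet> (\<i> *s (jmat *v v)) = ?c"
    using inner_adj[of "adj P" w] by (simp add: vector_scalar_commute)
  have 6: "(\<i> *s (jmat *v v)) \<bullet> (\<i> *s (jmat *v v)) = v \<bullet> v"
    by (simp add: inner_smult_left vector_smult_assoc inner_jmat)
  show ?thesis
    using 1 2 3 4[of y] 5 6
    by (simp add: inner_diff_left inner_diff_right matrix_vector_mult_diff_distrib inner_commute)
qed

lemma C_pos: "pos_def C"
  unfolding pos_def_iff
proof (intro conjI allI impI)
  fix v :: "complex^('p + 'p)" assume "v \<noteq> 0"
  show "0 < v \<bullet> (C *v v)"
  proof (rule ccontr)
    assume neg: "\<not> 0 < v \<bullet> (C *v v)"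
    define w where "w = adj B *v (T' *v (P' *v v))"
    let ?u = "adj P *v w - \<i> *s (jmat *v v)"
    \<comment> \<open>\<open>C_form\<close> is a sum of three nonnegative terms, so a nonpositive
      value makes each vanish. Definiteness of \<open>S\<close> gives \<open>w = 0\<close>, and then
      \<open>?u\<close> is just \<open>- \<i> *s (jmat *v v)\<close>.\<close>
    have "w \<bullet> (S *v w) \<le> 0" "?u \<bullet> ?u \<le> 0"
      using neg C_form[of v] pos_def_nonneg[OF posS] inner_ge_zero[of ?u]
      unfolding w_def[symmetric] by (smt (verit))+
    then have "w = 0" "?u = 0"
      using posS inner_ge_zero[of ?u] by (auto simp: pos_def_iff not_less[symmetric])
    then have "jmat *v v = 0" by simp
    then show False using \<open>v \<noteq> 0\<close> by (metis jmat_jmat_vec matrix_vector_mult_0_right)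
  qed
qed (rule adjC)

text \<open>As \<open>jmat\<close> is -1 on \<open>e\<close>, \<open>P' *v e\<close> arises from
  \<open>P *v e\<close> by applying I - \<open>\<i>\<close> \<open>B\<close>. This matrix commutes
  with \<open>A\<close>, so \<open>x'\<close> solves the equation for \<open>P'\<close>, and the
  system step preserves the shape of the vector up to a scalar. Both sides are scaled by
  \<open>z\<close> to avoid division.\<close>

lemma C_decay_step:
  assumes "jmat *v e = - e" "A *v x = z *s x + P *v e"
  defines "x' \<equiv> x - \<i> *s (B *v x)"
  shows "z *s (e - \<i> *s (jmat *v (adj P *v (T *v x))))
      - \<i> *s (jmat *v (C *v (e - \<i> *s (jmat *v (adj P *v (T *v x))))))
    = (z + \<i>) *s (e - \<i> *s (jmat *v (adj P' *v (T' *v x'))))"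
    and "A *v x' = z *s x' + P' *v e"
proof -
  have Pe: "P *v e = A *v x - z *s x" using assms(2) by simp
  have neg: "P *v (- e) = - (P *v e)"
    using vector_scalar_commute[of P "-1" e] by (simp add: vector_sneg_minus1[symmetric])
  have P'e: "P' *v e = A *v x - z *s x - \<i> *s x + (\<i> * z) *s (B *v x)"
    unfolding P'_vec assms(1) neg Pe
    using vector_scalar_commute[of B "-1"]
    by (simp add: mv_simps vec_eq_iff algebra_simps)
  show "A *v x' = z *s x' + P' *v e"
    unfolding x'_def P'e by (simp add: mv_simps vec_eq_iff algebra_simps)
  have *: "C *v (e - \<i> *s (jmat *v (adj P *v (T *v x))))
      = e - z *s (adj P *v (T *v x)) + (z + \<i>) *s (adj P' *v (T' *v x'))"
    unfolding matrix_vector_mult_diff_distrib vector_scalar_commute C_jPT x'_def C_vec[of e] P'e Pe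
    by (simp add: mv_simps vec_eq_iff algebra_simps)
  show "z *s (e - \<i> *s (jmat *v (adj P *v (T *v x))))
      - \<i> *s (jmat *v (C *v (e - \<i> *s (jmat *v (adj P *v (T *v x))))))
    = (z + \<i>) *s (e - \<i> *s (jmat *v (adj P' *v (T' *v x'))))"
    unfolding * by (simp add: mv_simps assms(1) vec_eq_iff algebra_simps)
qed

end

section \<open>The indefinite form of \<open>jmat\<close> along solutions\<close>

lemma inner_hermitian_smult:
  fixes M :: "complex^'n^'n"
  assumes "adj M = M"
  shows "x \<bullet> (c *s (M *v x)) = Re c * (x \<bullet> (M *v x))"
proof -
  \<comment> \<open>A Hermitian form is real, so its multiple by \<open>\<i>\<close> has no real
    part; this appears as a number equal to its own negative.\<close>
  have "x \<bullet> (\<i> *s (M *v x)) = - (x \<bullet> (\<i> *s (M *v x)))"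
    using inner_adj[of M x "\<i> *s x"] inner_smult_left[of \<i> x "M *v x"]
    by (simp add: assms vector_scalar_commute inner_commute vector_smult_lneg)
  moreover have "c *s (M *v x) = Re c *\<^sub>R (M *v x) + Im c *\<^sub>R (\<i> *s (M *v x))"
    by (simp add: vec_eq_iff complex_eq_iff)
  ultimately show ?thesis by (simp add: inner_simps)
qed

text \<open>With \<open>t = matrix_inv S *v x\<close>, \<open>ident\<close> turns the part quadratic
  in \<open>t\<close> into \<open>- 2 * (t \<bullet> (\<i> *s (A *v x)))\<close>, and the cross
  terms give \<open>2 * (t \<bullet> (\<i> *s (P *v e)))\<close>. The equation for \<open>x\<close>
  leaves the scalar \<open>\<i> * z\<close>, whose real part is \<open>- Im z\<close>.\<close>

lemma j_form_transfer:
  fixes A S :: "complex^'n^'n" and P :: "complex^('p::finite + 'p)^'n"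
  assumes ident: "A ** S - S ** adj A = smul \<i> (P ** jmat ** adj P)"
    and pos: "pos_def S" and x: "A *v x = z *s x + P *v e"
  defines "y \<equiv> e - \<i> *s (jmat *v (adj P *v (matrix_inv S *v x)))"
  shows "y \<bullet> (jmat *v y) = e \<bullet> (jmat *v e) + 2 * Im z * (x \<bullet> (matrix_inv S *v x))"
proof -
  let ?T = "matrix_inv S"
  have S: "adj S = S" "invertible S" using pos pos_def_invertible by (auto simp: pos_def_iff)
  have T: "adj ?T = ?T" using adj_matrix_inv[OF S(2)] S(1) by simp
  let ?t = "?T *v x"
  have St: "S *v ?t = x" using matrix_inv_vec[OF S(2)] by simp
  have "\<i> *s (P *v (jmat *v (adj P *v ?t))) = A *v x - S *v (adj A *v ?t)"
    using arg_cong[OF ident, of "\<lambda>M. M *v ?t"] by (simp add: mv_simps St)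
  from arg_cong[OF this, of "\<lambda>y. - \<i> *s y"]
  have PjP: "P *v (jmat *v (adj P *v ?t)) = - \<i> *s (A *v x - S *v (adj A *v ?t))"
    by (simp add: vector_smult_assoc)
  have q: "(adj P *v ?t) \<bullet> (jmat *v (adj P *v ?t)) = - 2 * (?t \<bullet> (\<i> *s (A *v x)))"
  proof -
    have "(adj P *v ?t) \<bullet> (jmat *v (adj P *v ?t)) = ?t \<bullet> (P *v (jmat *v (adj P *v ?t)))"
      using inner_adj[of "adj P" ?t] by simp
    also have "\<dots> = - (?t \<bullet> (\<i> *s (A *v x))) + ?t \<bullet> (\<i> *s (S *v (adj A *v ?t)))"
      by (simp add: PjP vector_ssub_ldistrib inner_simps vector_smult_lneg)
    also have "?t \<bullet> (\<i> *s (S *v (adj A *v ?t))) = - ((\<i> *s (A *v x)) \<bullet> ?t)"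
      using inner_adj[of S ?t "\<i> *s (adj A *v ?t)"] inner_adj[of A x ?t]
        inner_adj[of A x "\<i> *s ?t"] inner_smult_left[of \<i> "A *v x" ?t]
      by (simp add: S St vector_scalar_commute vector_smult_lneg)
    finally show ?thesis by (simp add: inner_commute)
  qed
  have c: "(jmat *v e) \<bullet> (\<i> *s (jmat *v (adj P *v ?t))) = - (?t \<bullet> (\<i> *s (P *v e)))"
    using inner_adj[of P e "\<i> *s ?t"] inner_smult_left[of \<i> "P *v e" ?t]
    by (simp add: inner_jmat vector_scalar_commute inner_commute vector_smult_lneg)
  have "y \<bullet> (jmat *v y) = e \<bullet> (jmat *v e) - 2 * ((jmat *v e) \<bullet> (\<i> *s (jmat *v (adj P *v ?t))))
      + (adj P *v ?t) \<bullet> (jmat *v (adj P *v ?t))"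
  proof -
    let ?r = "\<i> *s (jmat *v (adj P *v ?t))"
    have "y \<bullet> (jmat *v y) = e \<bullet> (jmat *v e) - 2 * ((jmat *v e) \<bullet> ?r) + ?r \<bullet> (jmat *v ?r)"
      unfolding y_def
      by (simp add: matrix_vector_mult_diff_distrib inner_simps inner_jmat[of e] inner_commute[of ?r "jmat *v e"])
    moreover have "?r \<bullet> (jmat *v ?r) = (adj P *v ?t) \<bullet> (jmat *v (adj P *v ?t))"
      by (simp add: vector_scalar_commute inner_smult_left vector_smult_assoc inner_jmat)
    ultimately show ?thesis by simp
  qed
  also have "\<dots> = e \<bullet> (jmat *v e) - 2 * (?t \<bullet> ((\<i> * z) *s x))"
    unfolding q c x by (simp add: vector_add_ldistrib inner_simps vector_smult_assoc)
  also have "?t \<bullet> ((\<i> * z) *s x) = - Im z * (x \<bullet> ?t)"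
    using inner_hermitian_smult[OF S(1), of ?t "\<i> * z"] by (simp add: St inner_commute)
  finally show ?thesis by simp
qed

text \<open>The cross terms carry \<open>Re (\<i> / z)\<close>, and
  \<open>C ** jmat ** C = jmat\<close> collapses the quadratic term to the original form. The factor
  \<open>1 + 1 / (cmod z)\<^sup>2\<close> is the reciprocal of \<open>qfun z\<close>, which explains
  the weight in the Weyl series.\<close>

lemma j_form_step:
  fixes C :: "complex^('p::finite + 'p)^('p + 'p)" and v :: "complex^('p + 'p)"
  assumes C: "adj C = C" "C ** jmat ** C = jmat" and z: "z \<noteq> 0"
  defines "v' \<equiv> v - (\<i> / z) *s (jmat *v (C *v v))"
  shows "v' \<bullet> (jmat *v v')
    = (1 + 1 / (cmod z)\<^sup>2) * (v \<bullet> (jmat *v v)) - 2 * Im z / (cmod z)\<^sup>2 * (v \<bullet> (C *v v))"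
proof -
  let ?c = "\<i> / z"
  have CjC: "C *v (jmat *v (C *v v)) = jmat *v v"
    using arg_cong[OF C(2), of "\<lambda>M. M *v v"] by (simp add: mv_simps)
  have Re: "Re ?c = Im z / (cmod z)\<^sup>2"
    by (simp add: Re_divide cmod_power2)
  have 1: "(?c *s (jmat *v (C *v v))) \<bullet> (jmat *v (?c *s (jmat *v (C *v v)))) = 1 / (cmod z)\<^sup>2 * (v \<bullet> (jmat *v v))"
  proof -
    have "(?c *s (jmat *v (C *v v))) \<bullet> (jmat *v (?c *s (jmat *v (C *v v))))
        = (jmat *v (C *v v)) \<bullet> ((cnj ?c * ?c) *s (C *v v))"
      by (simp add: vector_scalar_commute inner_smult_left vector_smult_assoc)
    also have "cnj ?c * ?c = complex_of_real (1 / (cmod z)\<^sup>2)"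
      using complex_norm_square[of z] by (simp add: field_simps)
    also have "complex_of_real (1 / (cmod z)\<^sup>2) *s (C *v v) = (1 / (cmod z)\<^sup>2) *\<^sub>R (C *v v)"
      by (simp add: vec_eq_iff scaleR_conv_of_real[where 'a = complex])
    also have "(jmat *v (C *v v)) \<bullet> ((1 / (cmod z)\<^sup>2) *\<^sub>R (C *v v)) = 1 / (cmod z)\<^sup>2 * (v \<bullet> (jmat *v v))"
      using inner_adj[of C v "jmat *v (C *v v)"] by (simp add: C CjC inner_commute)
    finally show ?thesis .
  qed
  have 2: "v \<bullet> (jmat *v (?c *s (jmat *v (C *v v)))) = Im z / (cmod z)\<^sup>2 * (v \<bullet> (C *v v))"
    using inner_hermitian_smult[OF C(1), of v ?c] Re by (simp add: vector_scalar_commute)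
  have 3: "(?c *s (jmat *v (C *v v))) \<bullet> (jmat *v v) = v \<bullet> (jmat *v (?c *s (jmat *v (C *v v))))"
    by (simp add: inner_jmat[symmetric] inner_commute)
  show ?thesis
    unfolding v'_def matrix_vector_mult_diff_distrib inner_diff_left inner_diff_right 1 3 2
    by (simp add: algebra_simps)
qed

text \<open>The form of \<open>C\<close> at \<open>v - jmat *v (C *v v)\<close> is twice the
  difference of the two sides.\<close>

lemma j_form_le:
  fixes C :: "complex^('p::finite + 'p)^('p + 'p)"
  assumes C: "pos_def C" "C ** jmat ** C = jmat"
  shows "v \<bullet> (jmat *v v) \<le> v \<bullet> (C *v v)"
proof -
  have C': "adj C = C" using C by (simp add: pos_def_iff)
  have CjC: "C *v (jmat *v (C *v w)) = jmat *v w" for w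
    using arg_cong[OF C(2), of "\<lambda>M. M *v w"] by (simp add: mv_simps)
  let ?u = "jmat *v (C *v v)"
  have "?u \<bullet> (C *v v) = v \<bullet> (jmat *v v)"
    using inner_adj[of C v ?u] by (simp add: C' CjC inner_commute)
  moreover have "?u \<bullet> (jmat *v v) = v \<bullet> (C *v v)"
    by (simp add: inner_jmat inner_commute)
  moreover have "(v - ?u) \<bullet> (C *v (v - ?u)) \<ge> 0" by (rule pos_def_nonneg[OF C(1)])
  ultimately show ?thesis
    by (simp add: matrix_vector_mult_diff_distrib inner_simps CjC)
qed


section \<open>Positive matrices and summable series of Hermitian matrices\<close>

lemma pos_def_matrix_inv:
  assumes "pos_def S"
  shows "pos_def (matrix_inv S)"
  unfolding pos_def_iff
proof (intro conjI allI impI)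
  have S: "adj S = S" "invertible S" using assms pos_def_invertible by (auto simp: pos_def_iff)
  show "adj (matrix_inv S) = matrix_inv S" using adj_matrix_inv[OF S(2)] S(1) by simp
  fix x :: "complex^'a" assume "x \<noteq> 0"
  then have "matrix_inv S *v x \<noteq> 0"
    by (metis matrix_inv_vec(1)[OF S(2)] matrix_vector_mult_0_right)
  then show "0 < x \<bullet> (matrix_inv S *v x)"
    using assms matrix_inv_vec(1)[OF S(2), of x] by (auto simp: pos_def_iff inner_commute)
qed

lemma pos_def_parallelogram_le:
  assumes "pos_def C"
  shows "(v - w) \<bullet> (C *v (v - w)) \<le> 2 * (v \<bullet> (C *v v)) + 2 * (w \<bullet> (C *v w))"
  using pos_def_nonneg[OF assms, of "v + w"]
  by (simp add: matrix_vector_right_distrib matrix_vector_mult_diff_distrib inner_simps)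

lemma summable_vec:
  fixes f :: "nat \<Rightarrow> 'a::real_normed_vector^'n"
  assumes "\<And>i. summable (\<lambda>k. f k $ i)"
  shows "summable f"
proof -
  have "f sums (\<chi> i. \<Sum>k. f k $ i)"
    unfolding sums_def using assms by (intro vec_tendstoI) (simp add: summable_LIMSEQ)
  then show ?thesis by (rule sums_summable)
qed

lemma scaleR_mult_vec: "(r *\<^sub>R M) *v x = r *\<^sub>R (M *v x)" for M :: "complex^'c^'r"
  by (simp add: vec_eq_iff matrix_vector_mult_def scaleR_sum_right)

lemma mult_vec_scaleR: "M *v (r *\<^sub>R x) = r *\<^sub>R (M *v x)" for M :: "complex^'c^'r"
  by (simp add: vec_eq_iff matrix_vector_mult_def scaleR_sum_right)

lemma entry_eq_inner:
  fixes M :: "complex^'c^'r"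
  shows "M $ a $ b = Complex (axis a 1 \<bullet> (M *v axis b 1)) (axis a \<i> \<bullet> (M *v axis b 1))"
proof -
  have "(M *v axis b 1) $ a = M $ a $ b"
    by (simp add: matrix_vector_mult_def axis_def if_distrib cong: if_cong)
  then show ?thesis by (simp add: complex_eq_iff inner_axis' inner_complex_def)
qed

text \<open>Polarization recovers the bilinear forms from the quadratic ones; testing against
  \<open>axis a 1\<close> and \<open>axis a \<i>\<close> then reads off the real and imaginary part
  of each entry.\<close>

lemma summable_hermitian_matrix:
  fixes M :: "nat \<Rightarrow> complex^'n^'n"
  assumes herm: "\<And>k. adj (M k) = M k" and form: "\<And>u. summable (\<lambda>k. u \<bullet> (M k *v u))"
  shows "summable M"
proof -
  have polar: "u \<bullet> (M k *v w) = ((u + w) \<bullet> (M k *v (u + w)) - u \<bullet> (M k *v u) - w \<bullet> (M k *v w)) / 2" for u w k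
    using inner_adj[of "M k" u w]
    by (simp add: herm matrix_vector_right_distrib inner_simps inner_commute)
  have "summable (\<lambda>k. ((u + w) \<bullet> (M k *v (u + w)) - u \<bullet> (M k *v u) - w \<bullet> (M k *v w)) / 2)" for u w
    by (intro summable_divide summable_diff form)
  then have "summable (\<lambda>k. u \<bullet> (M k *v w))" for u w
    by (simp only: polar[symmetric])
  then show ?thesis
    by (intro summable_vec) (subst entry_eq_inner, simp add: summable_complex_iff)
qed

lemma summable_matrix_form:
  fixes M :: "nat \<Rightarrow> complex^'n^'n"
  assumes "summable M"
  shows "summable (\<lambda>k. u \<bullet> (M k *v u))"
proof -
  have "linear (\<lambda>N :: complex^'n^'n. u \<bullet> (N *v u))"
    by (rule linearI) (simp_all add: matrix_vector_mult_add_rdistrib scaleR_mult_vec inner_simps)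
  then show ?thesis
    using bounded_linear.summable[OF _ assms] by (simp add: linear_conv_bounded_linear)
qed

section \<open>Holomorphy of matrix functions\<close>

lemma det_holomorphic:
  fixes F :: "complex \<Rightarrow> complex^'n^'n"
  assumes "\<And>i j. (\<lambda>z. F z $ i $ j) holomorphic_on U"
  shows "(\<lambda>z. det (F z)) holomorphic_on U"
  unfolding det_def by (intro holomorphic_intros assms)

lemma mult_holomorphic:
  fixes F :: "complex \<Rightarrow> complex^'b^'a" and G :: "complex \<Rightarrow> complex^'c^'b"
  assumes "\<And>i j. (\<lambda>z. F z $ i $ j) holomorphic_on U" "\<And>i j. (\<lambda>z. G z $ i $ j) holomorphic_on U"
  shows "(\<lambda>z. (F z ** G z) $ i $ j) holomorphic_on U"
  unfolding matrix_matrix_mult_def by (simp, intro holomorphic_intros assms)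

lemma matrix_inv_holomorphic:
  fixes F :: "complex \<Rightarrow> complex^'n^'n"
  assumes F: "\<And>i j. (\<lambda>z. F z $ i $ j) holomorphic_on U" and inv: "\<And>z. z \<in> U \<Longrightarrow> invertible (F z)"
  shows "(\<lambda>z. matrix_inv (F z) $ i $ j) holomorphic_on U"
proof -
  \<comment> \<open>Cramer's rule: with column \<open>i\<close> replaced by the unit vector
    \<open>axis j 1\<close>, each entry of the inverse is a quotient of determinants.\<close>
  let ?G = "\<lambda>z. \<chi> a b. if b = i then axis j 1 $ a else F z $ a $ b"
  have nz: "det (F z) \<noteq> 0" if "z \<in> U" for z using inv[OF that] by (simp add: invertible_det_nz)
  have "matrix_inv (F z) $ i $ j = det (?G z) / det (F z)" if "z \<in> U" for z
  proof -
    have "matrix_inv (F z) *v axis j 1 = (\<chi> k. det (\<chi> a b. if b = k then axis j 1 $ a else F z $ a $ b) / det (F z))"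
      using cramer[OF nz[OF that]] matrix_inv_vec(1)[OF inv[OF that]] by blast
    moreover have "(matrix_inv (F z) *v axis j 1) $ i = matrix_inv (F z) $ i $ j"
      by (simp add: matrix_vector_mult_def axis_def if_distrib cong: if_cong)
    ultimately show ?thesis by simp
  qed
  moreover have "(\<lambda>z. det (?G z) / det (F z)) holomorphic_on U"
  proof (intro holomorphic_on_divide det_holomorphic F nz)
    show "(\<lambda>z. ?G z $ a $ b) holomorphic_on U" for a b by (cases "b = i") (simp_all add: F)
  qed auto
  ultimately show ?thesis by (simp cong: holomorphic_cong)
qed

section \<open>Energy balance along the system\<close>

lemma qfun_nonneg: "0 \<le> qfun z"
  by (simp add: qfun_def)

text \<open>The weight cancels the growth factor of \<open>j_form_step\<close>, so the increments of
  \<open>h\<close> are multiples of the energy terms \<open>a\<close>, with a positive factor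
  because \<open>Im z < 0\<close>.\<close>

lemma energy_balance:
  fixes C :: "nat \<Rightarrow> complex^('p::finite + 'p)^('p + 'p)" and v :: "complex^('p + 'p)"
  assumes C: "\<And>k. pos_def (C k)" "\<And>k. C k ** jmat ** C k = jmat" and z: "Im z < 0"
  defines "h \<equiv> \<lambda>k. qfun z ^ k * ((Wsol C z k *v v) \<bullet> (jmat *v (Wsol C z k *v v)))"
    and "a \<equiv> \<lambda>k. qfun z ^ k * ((Wsol C z k *v v) \<bullet> (C k *v (Wsol C z k *v v)))"
  shows "h (Suc k) = h k - 2 * Im z / ((cmod z)\<^sup>2 + 1) * a k" "h k \<le> a k" "0 \<le> a k"
proof -
  have z0: "z \<noteq> 0" using z by auto
  let ?w = "Wsol C z k *v v"
  have "Wsol C z (Suc k) *v v = ?w - (\<i> / z) *s (jmat *v (C k *v ?w))"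
    by (simp add: mv_simps)
  then have J: "(Wsol C z (Suc k) *v v) \<bullet> (jmat *v (Wsol C z (Suc k) *v v))
     = (1 + 1 / (cmod z)\<^sup>2) * (?w \<bullet> (jmat *v ?w)) - 2 * Im z / (cmod z)\<^sup>2 * (?w \<bullet> (C k *v ?w))"
    using j_form_step[of "C k" z ?w] C z0 by (simp add: pos_def_iff)
  have "h (Suc k) = qfun z ^ k * (qfun z * (1 + 1 / (cmod z)\<^sup>2) * (?w \<bullet> (jmat *v ?w))
       - qfun z * (2 * Im z / (cmod z)\<^sup>2) * (?w \<bullet> (C k *v ?w)))"
    unfolding h_def power_Suc J by (simp add: algebra_simps)
  also have "qfun z * (1 + 1 / (cmod z)\<^sup>2) = 1"
  proof -
    have "1 + 1 / (cmod z)\<^sup>2 = ((cmod z)\<^sup>2 + 1) / (cmod z)\<^sup>2" "(cmod z)\<^sup>2 + 1 \<noteq> 0"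
      using z0 sum_power2_gt_zero_iff[of "cmod z" 1] by (simp_all add: field_simps)
    then show ?thesis using z0 by (simp add: qfun_def)
  qed
  also have "qfun z * (2 * Im z / (cmod z)\<^sup>2) = 2 * Im z / ((cmod z)\<^sup>2 + 1)"
    using z0 by (simp add: qfun_def)
  finally show "h (Suc k) = h k - 2 * Im z / ((cmod z)\<^sup>2 + 1) * a k"
    by (simp add: h_def a_def algebra_simps)
  show "h k \<le> a k" "0 \<le> a k"
    unfolding h_def a_def using qfun_nonneg[of z] j_form_le[OF C] pos_def_nonneg[OF C(1)]
    by (auto intro: mult_left_mono)
qed

section \<open>The system and the solution started from the candidate Weyl function\<close>

locale weyl_system =
  fixes A S0 :: "complex^'n^'n" and Phi Psi :: "complex^'p^'n"
  assumes detA: "det A \<noteq> 0" and S0pos: "pos_def S0"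
    and identity: "A ** S0 - S0 ** adj A = smul \<i> (hblock Phi Psi ** jmat ** adj (hblock Phi Psi))"
begin

abbreviation "Pk \<equiv> PiSeq A (hblock Phi Psi)"
abbreviation "Sk \<equiv> SSeq A S0 (hblock Phi Psi)"
abbreviation "Ck \<equiv> CSeq A S0 (hblock Phi Psi)"
abbreviation "T0 \<equiv> matrix_inv S0"
text \<open>The shift by \<open>z\<close> is included, so \<open>matrix_inv (Ax z)\<close> is the
  resolvent of \<open>Ax 0\<close>.\<close>

abbreviation "Ax z \<equiv> A + smul \<i> (Psi ** adj Psi ** T0) - smul z (mat 1)"
abbreviation "weyl z \<equiv> smul (-\<i>) (adj Phi ** T0 ** matrix_inv (Ax z) ** Psi)"

lemma step: "backlund_step A (Sk k) (Sk (Suc k)) (Pk k) (Pk (Suc k))"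
proof (induction k)
  case 0
  show ?case using detA S0pos identity by unfold_locales (simp_all add: invertible_det_nz)
next
  case (Suc k)
  then interpret backlund_step A "Sk k" "Sk (Suc k)" "Pk k" "Pk (Suc k)" .
  show ?case using invA S'_pos ident' by unfold_locales simp_all
qed

lemma Ck_eq: "Ck k = backlund_step.C (Sk k) (Sk (Suc k)) (Pk k) (Pk (Suc k))"
  using backlund_step.C_def[OF step] by (simp add: CSeq_def)

lemma Sk_pos: "pos_def (Sk k)"
  using backlund_step.posS[OF step] .

lemma Ck_pos: "pos_def (Ck k)"
  using backlund_step.C_pos[OF step] by (simp add: Ck_eq)

lemma Ck_j_Ck: "Ck k ** jmat ** Ck k = jmat"
  using backlund_step.CjC[OF step] by (simp add: Ck_eq)

text \<open>Moving the rank correction to the right-hand side shows that \<open>x\<close> and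
  \<open>e\<close> satisfy the hypotheses of \<open>C_decay_step\<close>. The resulting start vector
  has lower block \<open>u\<close>; its upper block is \<open>weyl z *v u\<close> once
  \<open>Ax z\<close> is invertible.\<close>

lemma weyl_vector:
  assumes "Ax z *v x = Psi *v u"
  defines "e \<equiv> vpair 0 (u - \<i> *s (adj Psi *v (T0 *v x)))"
  shows "jmat *v e = - e" "A *v x = z *s x + hblock Phi Psi *v e"
    "e - \<i> *s (jmat *v (adj (hblock Phi Psi) *v (T0 *v x))) = vpair (-\<i> *s (adj Phi *v (T0 *v x))) u"
proof -
  show "jmat *v e = - e" by (simp add: e_def jmat_vpair vec_eq_iff_sum)
  show "A *v x = z *s x + hblock Phi Psi *v e"
    using assms(1) by (simp add: e_def hblock_vpair mv_simps vec_eq_iff algebra_simps)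
  show "e - \<i> *s (jmat *v (adj (hblock Phi Psi) *v (T0 *v x))) = vpair (-\<i> *s (adj Phi *v (T0 *v x))) u"
    by (simp add: e_def adj_hblock_vec jmat_vpair vec_eq_iff_sum)
qed

text \<open>A kernel vector is the case \<open>u = 0\<close> of \<open>weyl_vector\<close>. The
  start vector then has lower block 0, hence a nonnegative form, whereas
  \<open>j_form_transfer\<close> makes that form negative.\<close>

lemma Ax_invertible:
  assumes "Im z < 0"
  shows "invertible (Ax z)"
proof (rule invertible_if_inj, rule ccontr)
  fix x assume 0: "Ax z *v x = 0" and "x \<noteq> 0"
  define e where "e = vpair 0 (0 - \<i> *s (adj Psi *v (T0 *v x)))"
  note w = weyl_vector[of z x 0, folded e_def]
  have "vpair (-\<i> *s (adj Phi *v (T0 *v x))) 0 \<bullet> (jmat *v vpair (-\<i> *s (adj Phi *v (T0 *v x))) 0)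
     = e \<bullet> (jmat *v e) + 2 * Im z * (x \<bullet> (T0 *v x))"
    using j_form_transfer[OF identity S0pos w(2)] w(3) 0 by simp
  then have "0 \<le> - (e \<bullet> e) + 2 * Im z * (x \<bullet> (T0 *v x))"
    using w(1) 0 by (simp add: jmat_vpair inner_vpair) (smt (verit) inner_ge_zero)
  moreover have "0 < x \<bullet> (T0 *v x)"
    using pos_def_matrix_inv[OF S0pos] \<open>x \<noteq> 0\<close> by (simp add: pos_def_iff)
  ultimately show False using assms inner_ge_zero[of e] mult_neg_pos[of "Im z"] by fastforce
qed

text \<open>The witness \<open>y\<close> is \<open>x\<close> after \<open>k\<close> applications of
  I - \<open>\<i>\<close> \<open>matrix_inv A\<close>; the later estimate works from its equation,
  hence the existential form.\<close>

lemma Wsol_weyl: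
  fixes u :: "complex^'p"
  assumes z: "Im z < 0"
  defines "x \<equiv> matrix_inv (Ax z) *v (Psi *v u)"
  defines "e \<equiv> vpair 0 (u - \<i> *s (adj Psi *v (T0 *v x)))"
  shows "\<exists>y. A *v y = z *s y + Pk k *v e \<and>
    Wsol Ck z k *v (vblock_id (weyl z) *v u)
      = (1 + \<i> / z) ^ k *s (e - \<i> *s (jmat *v (adj (Pk k) *v (matrix_inv (Sk k) *v y))))"
proof (induction k)
  case 0
  have "Ax z *v x = Psi *v u"
    unfolding x_def by (rule matrix_inv_vec(1)[OF Ax_invertible[OF z]])
  from weyl_vector[OF this, folded e_def] show ?case
    by (intro exI[of _ x])
      (simp add: vblock_id_vec x_def smul_mult_vec matrix_vector_mul_assoc[symmetric] vector_smult_lneg)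
next
  case (Suc k)
  then obtain y where y: "A *v y = z *s y + Pk k *v e"
    and W: "Wsol Ck z k *v (vblock_id (weyl z) *v u)
      = (1 + \<i> / z) ^ k *s (e - \<i> *s (jmat *v (adj (Pk k) *v (matrix_inv (Sk k) *v y))))" by blast
  have z0: "z \<noteq> 0" using z by auto
  have je: "jmat *v e = - e" by (simp add: e_def jmat_vpair vec_eq_iff_sum)
  define y' where "y' = y - \<i> *s (matrix_inv A *v y)"
  let ?Y = "e - \<i> *s (jmat *v (adj (Pk k) *v (matrix_inv (Sk k) *v y)))"
  let ?Y' = "e - \<i> *s (jmat *v (adj (Pk (Suc k)) *v (matrix_inv (Sk (Suc k)) *v y')))"
  note st = backlund_step.C_decay_step[OF step je y, folded y'_def Ck_eq]
  have "?Y - (\<i> / z) *s (jmat *v (Ck k *v ?Y)) = (1 / z) *s (z *s ?Y - \<i> *s (jmat *v (Ck k *v ?Y)))"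
    using z0 by (simp add: vec_eq_iff field_simps)
  also have "\<dots> = (1 + \<i> / z) *s ?Y'"
  proof -
    have "1 / z * (z + \<i>) = 1 + \<i> / z" using z0 by (simp add: add_divide_distrib)
    then show ?thesis by (simp only: st(1) vector_smult_assoc)
  qed
  finally have Y: "?Y - (\<i> / z) *s (jmat *v (Ck k *v ?Y)) = (1 + \<i> / z) *s ?Y'" .
  have "Wsol Ck z (Suc k) *v (vblock_id (weyl z) *v u)
      = (1 + \<i> / z) ^ k *s (?Y - (\<i> / z) *s (jmat *v (Ck k *v ?Y)))"
    unfolding Wsol.simps matrix_vector_mult_diff_rdistrib smul_mult_vec matrix_vector_mul_assoc[symmetric] W
      vector_scalar_commute
    by (simp only: vector_ssub_ldistrib vector_smult_assoc mult.commute)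
  also have "\<dots> = (1 + \<i> / z) ^ Suc k *s ?Y'"
    unfolding Y by (simp only: vector_smult_assoc power_Suc mult.commute)
  finally show ?case using st(2) by blast
qed

text \<open>\<open>j_form_transfer\<close> gives the sign, and the scalar contributes its squared
  modulus. At \<open>z = - \<i>\<close> this scalar vanishes for positive \<open>k\<close>, which
  the weak inequality allows.\<close>

lemma weyl_j_form_nonpos:
  assumes z: "Im z < 0"
  defines "w \<equiv> \<lambda>k u. Wsol Ck z k *v (vblock_id (weyl z) *v u)"
  shows "w k u \<bullet> (jmat *v w k u) \<le> 0"
proof -
  define e where "e = vpair 0 (u - \<i> *s (adj Psi *v (T0 *v (matrix_inv (Ax z) *v (Psi *v u)))))"
  obtain y where y: "A *v y = z *s y + Pk k *v e"
    and W: "w k u = (1 + \<i> / z) ^ k *s (e - \<i> *s (jmat *v (adj (Pk k) *v (matrix_inv (Sk k) *v y))))"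
    (is "_ = ?c *s ?Y")
    unfolding w_def e_def using Wsol_weyl[OF z] by blast
  have "jmat *v e = - e" by (simp add: e_def jmat_vpair vec_eq_iff_sum)
  then have "?Y \<bullet> (jmat *v ?Y) = - (e \<bullet> e) + 2 * Im z * (y \<bullet> (matrix_inv (Sk k) *v y))"
    using j_form_transfer[OF backlund_step.ident[OF step] Sk_pos y] by simp
  also have "\<dots> \<le> 0"
    using mult_nonpos_nonneg[OF less_imp_le[OF z] pos_def_nonneg[OF pos_def_matrix_inv[OF Sk_pos]], of y k]
      inner_ge_zero[of e] by linarith
  finally have "?Y \<bullet> (jmat *v ?Y) \<le> 0" .
  moreover have "w k u \<bullet> (jmat *v w k u) = (cmod ?c)\<^sup>2 * (?Y \<bullet> (jmat *v ?Y))"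
  proof -
    have "w k u \<bullet> (jmat *v w k u) = ?Y \<bullet> ((cnj ?c * ?c) *s (jmat *v ?Y))"
      unfolding W by (simp only: vector_scalar_commute inner_smult_left vector_smult_assoc)
    also have "cnj ?c * ?c = complex_of_real ((cmod ?c)\<^sup>2)"
      using complex_norm_square[of ?c] by (simp only: mult.commute)
    finally show ?thesis using inner_hermitian_smult[OF adj_jmat, of ?Y] by (simp only: Re_complex_of_real)
  qed
  ultimately show ?thesis by (simp add: mult_nonneg_nonpos)
qed

section \<open>Convergence and uniqueness through the energy\<close>

definition "energy z \<phi> k = adj (vblock_id \<phi>) ** (qfun z ^ k *\<^sub>R (adj (Wsol Ck z k) ** Ck k ** Wsol Ck z k)) ** vblock_id \<phi>"

lemma energy_form: "u \<bullet> (energy z \<phi> k *v u) = qfun z ^ k *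
    ((Wsol Ck z k *v (vblock_id \<phi> *v u)) \<bullet> (Ck k *v (Wsol Ck z k *v (vblock_id \<phi> *v u))))"
  by (simp add: energy_def matrix_vector_mul_assoc[symmetric] scaleR_mult_vec mult_vec_scaleR inner_adj)

lemma energy_hermitian: "adj (energy z \<phi> k) = energy z \<phi> k"
  using Ck_pos[of k] by (simp add: energy_def adj_mult adj_scaleR pos_def_iff matrix_mul_assoc)

lemma energy_summable:
  assumes z: "Im z < 0"
  shows "summable (energy z (weyl z))"
proof (rule summable_hermitian_matrix[OF energy_hermitian])
  fix u
  let ?v = "vblock_id (weyl z) *v u"
  define h where "h k = qfun z ^ k * ((Wsol Ck z k *v ?v) \<bullet> (jmat *v (Wsol Ck z k *v ?v)))" for k
  define a where "a k = u \<bullet> (energy z (weyl z) k *v u)" for k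
  define c where "c = - (2 * Im z) / ((cmod z)\<^sup>2 + 1)"
  note st = energy_balance[where C = Ck and z = z and v = ?v, OF Ck_pos Ck_j_Ck z, folded energy_form, folded h_def a_def]
  have c: "0 < c" using z unfolding c_def by (intro divide_pos_pos add_nonneg_pos) auto
  have "h (Suc k) = h k + c * a k" for k unfolding st(1) c_def by simp
  \<comment> \<open>Telescoping; as \<open>h N \<le> 0\<close>, all partial sums stay below
    \<open>- h 0 / c\<close>.\<close>
  then have sum: "c * (\<Sum>k<N. a k) = h N - h 0" for N
    by (induction N) (simp_all add: distrib_left)
  have "h N \<le> 0" for N
    unfolding h_def using weyl_j_form_nonpos[OF z] by (simp add: mult_nonneg_nonpos qfun_def)
  then have "(\<Sum>k<N. a k) \<le> - h 0 / c" for N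
    unfolding pos_le_divide_eq[OF c] using sum[of N] by (simp add: mult.commute)
  with st(3) have "summable a" by (intro summableI_nonneg_bounded) auto
  then show "summable (\<lambda>k. u \<bullet> (energy z (weyl z) k *v u))" by (simp add: a_def[abs_def])
qed

lemma energy_unique:
  assumes z: "Im z < 0" and \<phi>: "summable (energy z \<phi>)"
  shows "\<phi> = weyl z"
  unfolding matrix_eq
proof (rule allI, rule ccontr)
  fix u assume "\<phi> *v u \<noteq> weyl z *v u"
  define f where "f = \<phi> *v u - weyl z *v u"
  have "f \<noteq> 0" using \<open>\<phi> *v u \<noteq> _\<close> by (simp add: f_def)
  \<comment> \<open>Both block columns map \<open>u\<close> to vectors with lower block
    \<open>u\<close>, so the difference has lower block 0 and \<open>h\<close> starts at
    \<open>f \<bullet> f\<close>.\<close>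
  define v where "v = vpair f 0"
  have v: "v = vblock_id \<phi> *v u - vblock_id (weyl z) *v u"
    by (simp add: v_def f_def vblock_id_vec vec_eq_iff_sum)
  define h where "h k = qfun z ^ k * ((Wsol Ck z k *v v) \<bullet> (jmat *v (Wsol Ck z k *v v)))" for k
  define a where "a k = qfun z ^ k * ((Wsol Ck z k *v v) \<bullet> (Ck k *v (Wsol Ck z k *v v)))" for k
  note st = energy_balance[where C = Ck and z = z and v = v, OF Ck_pos Ck_j_Ck z, folded h_def a_def]
  have "h k \<le> h (Suc k)" for k
    unfolding st(1) using z st(3)[of k]
    by (simp add: mult_nonpos_nonneg divide_nonpos_nonneg)
  then have "h 0 \<le> h k" for k by (rule lift_Suc_mono_le) simp
  moreover have "h 0 = f \<bullet> f" by (simp add: h_def v_def jmat_vpair inner_vpair)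
  ultimately have low: "f \<bullet> f \<le> a k" for k using st(2)[of k] by (metis order_trans)
  \<comment> \<open>The terms \<open>a k\<close> stay above \<open>f \<bullet> f\<close>, yet are
    dominated by two energies that tend to 0 by summability.\<close>
  have "a k \<le> 2 * (u \<bullet> (energy z \<phi> k *v u)) + 2 * (u \<bullet> (energy z (weyl z) k *v u))" for k
    unfolding energy_form a_def v matrix_vector_mult_diff_distrib[of "Wsol Ck z k"]
    using mult_left_mono[OF pos_def_parallelogram_le[OF Ck_pos[of k]], of "qfun z ^ k"]
    by (simp only: qfun_nonneg zero_le_power distrib_left mult.left_commute[of 2])
  then have bound: "f \<bullet> f \<le> 2 * (u \<bullet> (energy z \<phi> k *v u)) + 2 * (u \<bullet> (energy z (weyl z) k *v u))" for k
    using low order_trans by blast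
  have "(\<lambda>k. 2 * (u \<bullet> (energy z \<phi> k *v u)) + 2 * (u \<bullet> (energy z (weyl z) k *v u))) \<longlonglongrightarrow> 2 * 0 + 2 * 0"
    using summable_LIMSEQ_zero[OF summable_matrix_form[OF \<phi>]]
      summable_LIMSEQ_zero[OF summable_matrix_form[OF energy_summable[OF z]]]
    by (intro tendsto_intros) auto
  then have "f \<bullet> f \<le> 2 * 0 + 2 * 0"
    using bound by (intro LIMSEQ_le_const) auto
  moreover have "0 < f \<bullet> f" using \<open>f \<noteq> 0\<close> by simp
  ultimately show False by simp
qed

section \<open>Holomorphy and characterization of the Weyl function\<close>

lemma weyl_holomorphic: "(\<lambda>z. weyl z $ a $ b) holomorphic_on lower_half"
proof -
  have const: "(\<lambda>z. N $ i $ j) holomorphic_on lower_half" for N :: "complex^'x^'y" and i j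
    by (rule holomorphic_on_const)
  have "(\<lambda>z. Ax z $ i $ j) holomorphic_on lower_half" for i j
    by (simp add: smul_def) (intro holomorphic_intros)
  then have "(\<lambda>z. matrix_inv (Ax z) $ i $ j) holomorphic_on lower_half" for i j
    by (rule matrix_inv_holomorphic) (simp add: Ax_invertible lower_half_def)
  then have "(\<lambda>z. (adj Phi ** T0 ** matrix_inv (Ax z) ** Psi) $ a $ b) holomorphic_on lower_half"
    by (intro mult_holomorphic const)
  then show ?thesis unfolding smul_def by (simp, intro holomorphic_intros)
qed

text \<open>The definition constrains \<open>\<phi>\<close> on the half-plane only, so uniqueness
  means agreement there.\<close>

lemma weyl_function_iff:
  "is_weyl_function Ck \<phi> \<longleftrightarrow> (\<forall>z\<in>lower_half. \<phi> z = weyl z)"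
proof
  assume "is_weyl_function Ck \<phi>"
  then show "\<forall>z\<in>lower_half. \<phi> z = weyl z"
    unfolding is_weyl_function_def energy_def[symmetric]
    by (auto simp: lower_half_def intro: energy_unique)
next
  assume eq: "\<forall>z\<in>lower_half. \<phi> z = weyl z"
  have "(\<lambda>z. \<phi> z $ a $ b) holomorphic_on lower_half" for a b
    using weyl_holomorphic[of a b] by (rule holomorphic_transform) (simp add: eq)
  moreover have "summable (energy z (\<phi> z))" if "z \<in> lower_half" for z
    using energy_summable[of z] that eq by (simp add: lower_half_def)
  ultimately show "is_weyl_function Ck \<phi>"
    unfolding is_weyl_function_def energy_def[symmetric] by blast
qed

end

text \<open>Since \<open>matrix_inv\<close> is total, well-definedness of the system and of the
  formula is expressed by separate invertibility claims. Existence and uniqueness are the two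
  directions of the equivalence.\<close>

theorem theorem4p2:
  fixes A S0 :: "complex^'n^'n"
    and Phi Psi :: "complex^'p^'n"
  assumes detA: "det A \<noteq> 0"
    and S0pos: "pos_def S0"
    and identity: "A ** S0 - S0 ** adj A = smul \<i> (hblock Phi Psi ** jmat ** adj (hblock Phi Psi))"
  shows "(\<forall>k. invertible (SSeq A S0 (hblock Phi Psi) k)
              \<and> pos_def (CSeq A S0 (hblock Phi Psi) k)
              \<and> CSeq A S0 (hblock Phi Psi) k ** jmat ** CSeq A S0 (hblock Phi Psi) k = jmat)
       \<and> (\<forall>z\<in>lower_half. invertible (A + smul \<i> (Psi ** adj Psi ** matrix_inv S0) - smul z (mat 1)))
       \<and> (\<forall>\<phi>. is_weyl_function (CSeq A S0 (hblock Phi Psi)) \<phi> \<longleftrightarrow>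
              (\<forall>z\<in>lower_half. \<phi> z = smul (-\<i>) (adj Phi ** matrix_inv S0
                  ** matrix_inv (A + smul \<i> (Psi ** adj Psi ** matrix_inv S0) - smul z (mat 1)) ** Psi)))"
proof -
  interpret weyl_system A S0 Phi Psi by unfold_locales (fact assms)+
  show ?thesis
    using pos_def_invertible[OF Sk_pos] Ck_pos Ck_j_Ck Ax_invertible weyl_function_iff
    by (simp add: lower_half_def)
qed

end
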